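(* Let $A=A^{[012]}$ be the simplicial cochain dg-algebra of the $2$-simplex over $\mathbb Z_2$, and let $F^{[012]}$, $F^{[01]}$, $F^{[02]}$, $F^{[12]}$ be the families of maps $\{\underline A^{\otimes p}\otimes A\otimes\underline A^{\otimes q}\to A^*\}_{p,q\ge0}$ defined in the context. Then $$\mathcal D F^{[012]}=F^{[01]}+F^{[02]}+F^{[12]}.$$
   Context: The ground ring is $\mathbb Z_2$, so signs are omitted. Differentials lower degree by one. $\underline A$ denotes $A$ shifted up by one, $\underline A_j=A_{j-1}$, and $A^*$ is the dual, $A^*_j=\mathrm{Hom}(A_{-j},\mathbb Z_2)$. **The operator $\mathcal D$.** For a unital dg-algebra $A$ and a family $F=\{F_{p,q}:\underline A^{\otimes p}\otimes A\otimes\underline A^{\otimes q}\to A^*\}_{p,q\ge0}$ define $\mathcal D F$ as follows: $(\mathcal DF)_{p,q}(\underline{a_1},\dots,\underline{a_p};m;\underline{b_1},\dots,\underline{b_q})(n)$ is the sum of all terms obtained from $F_{p,q}(\underline{a_1},\dots,\underline{a_p};m;\underline{b_1},\dots,\underline{b_q})(n)$ by applying $d$ to exactly one of the inputs $a_1,\dots,a_p,m,b_1,\dots,b_q,n$, plus the following terms: if $p\ge1$, $F_{p-1,q}(\underline{a_2},\dots,\underline{a_p};m;\underline{b_1},\dots,\underline{b_q})(n a_1)$, $\sum_{j=1}^{p-1}F_{p-1,q}(\underline{a_1},\dots,\underline{a_ja_{j+1}},\dots,\underline{a_p};m;\underline{b_1},\dots,\underline{b_q})(n)$, $F_{p-1,q}(\underline{a_1},\dots,\underline{a_{p-1}};a_pm;\underline{b_1},\dots,\underline{b_q})(n)$;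 if $q\ge1$, $F_{p,q-1}(\underline{a_1},\dots,\underline{a_p};mb_1;\underline{b_2},\dots,\underline{b_q})(n)$, $\sum_{j=1}^{q-1}F_{p,q-1}(\underline{a_1},\dots,\underline{a_p};m;\underline{b_1},\dots,\underline{b_jb_{j+1}},\dots,\underline{b_q})(n)$, $F_{p,q-1}(\underline{a_1},\dots,\underline{a_p};m;\underline{b_1},\dots,\underline{b_{q-1}})(b_qn)$. **The algebra $A^{[012]}$.** Basis $e_0,e_1,e_2$ (degree $0$), $b_{01},b_{02},b_{12}$ (degree $-1$), $c_{012}$ (degree $-2$); differential $d(e_0)=b_{01}+b_{02}$, $d(e_1)=b_{01}+b_{12}$, $d(e_2)=b_{02}+b_{12}$, $d(b_{ij})=c_{012}$ for all $i<j$, $d(c_{012})=0$. Non-zero products of basis elements: $e_je_j=e_j$; $e_ib_{ij}=b_{ij}=b_{ij}e_j$ for $i<j$; $e_0c_{012}=c_{012}=c_{012}e_2$; $b_{01}b_{12}=c_{012}$. The unit is $e_0+e_1+e_2$. **The maps $F^{[ij]}$** ($0\le i<j\le 2$). Only components with $q=0$ are non-zero, and the only non-zero values on basis elements of $A^{[012]}$ are, for all $k\ge0$ (with $k$ copies of $\underline{b_{ij}}$ before the semicolon): $F^{[ij]}_{k,0}(\underline{b_{ij}},\dots,\underline{b_{ij}};e_i)(b_{ij})=1$ and $F^{[ij]}_{k,0}(\underline{b_{ij}},\dots,\underline{b_{ij}};b_{ij})(e_j)=1$. **The maps $F^{[012]}$.** Only components with $q=0$ are non-zero, and the only non-zero values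 on basis elements are the following. (i) For all $k\ge0$ (with $k$ copies of $\underline{b_{02}}$): $F^{[012]}_{k,0}(\underline{b_{02}},\dots,\underline{b_{02}};m)(n)=1$ for $(m,n)\in\{(c_{012},e_2),(e_0,c_{012}),(b_{01},b_{12})\}$. (ii) For all $k\ge0$ and $1\le\ell\le k+1$, with $\underline{c_{012}}$ in the $\ell$-th of the $k+1$ positions: $F^{[012]}_{k+1,0}(\underline{b_{01}},\dots,\underline{b_{01}},\underline{c_{012}},\underline{b_{02}},\dots,\underline{b_{02}};m)(n)=1$ for $(m,n)\in\{(e_0,b_{01}),(b_{01},e_1)\}$, and $F^{[012]}_{k+1,0}(\underline{b_{02}},\dots,\underline{b_{02}},\underline{c_{012}},\underline{b_{12}},\dots,\underline{b_{12}};m)(n)=1$ for $(m,n)\in\{(e_1,b_{12}),(b_{12},e_2)\}$. (iii) For all $k\ge0$ and $1\le\ell_1<\ell_2\le k+2$, with $\underline{c_{012}}$ in positions $\ell_1$ and $\ell_2$ of the $k+2$ positions: $F^{[012]}_{k+2,0}(\underline{b_{01}},\dots,\underline{b_{01}},\underline{c_{012}},\underline{b_{02}},\dots,\underline{b_{02}},\underline{c_{012}},\underline{b_{12}},\dots,\underline{b_{12}};e_1)(e_1)=1$. *)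

theory Defs
  imports "HOL-Library.Z2" "HOL-Library.Function_Algebras"
begin

section \<open>Unital dg-algebras over the field with two elements\<close>

text \<open>
  A vector space over the two-element field (type \<^typ>\<open>bit\<close>) is an abelian group in which every
  element is its own negative, and linear maps are additive maps; so no scalar multiplication is
  needed. The sort \<open>{ring, monoid_mult}\<close> is that of unital rings, the zero ring included.
  In the Leibniz rule the sign is omitted.
\<close>

class dg_algebra = ring + monoid_mult +
  fixes homogeneous :: "int \<Rightarrow> 'a set"
    and differential :: "'a \<Rightarrow> 'a"
  assumes char_two: "x + x = 0"
    and zero_homogeneous: "0 \<in> homogeneous i"
    and add_homogeneous: "x \<in> homogeneous i \<Longrightarrow> y \<in> homogeneous i \<Longrightarrow> x + y \<in> homogeneous i"
    and homogeneous_decomposition: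
      "\<exists>!f. (\<forall>i. f i \<in> homogeneous i) \<and> finite {i. f i \<noteq> 0} \<and> x = sum f {i. f i \<noteq> 0}"
    and one_homogeneous: "1 \<in> homogeneous 0"
    and mult_homogeneous:
      "x \<in> homogeneous i \<Longrightarrow> y \<in> homogeneous j \<Longrightarrow> x * y \<in> homogeneous (i + j)"
    and differential_homogeneous:
      "x \<in> homogeneous i \<Longrightarrow> differential x \<in> homogeneous (i - 1)"
    and differential_add: "differential (x + y) = differential x + differential y"
    and differential_differential: "differential (differential x) = 0"
    and differential_mult:
      "differential (x * y) = differential x * y + x * differential y"

section \<open>Families of maps and the operator D\<close>

text \<open>
  A linear map from the tensor product of \<open>p\<close> copies of \<open>A\<close>, one copy of \<open>A\<close> and \<open>q\<close> copies of
  \<open>A\<close> to the dual of \<open>A\<close> is a multilinear function of \<open>p + 1 + q\<close> arguments and one further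
  argument \<open>n\<close>, at which the resulting functional is evaluated. A family indexed by all \<open>p\<close>, \<open>q\<close> is
  a single function of lists: \<open>F as m bs n\<close> is the value of the component with \<open>p = length as\<close> and
  \<open>q = length bs\<close>. The degree shift on the outer inputs changes neither underlying
  elements nor, in characteristic two, any sign, so it does not appear in the types.
\<close>

type_synonym 'a family = "'a list \<Rightarrow> 'a \<Rightarrow> 'a list \<Rightarrow> 'a \<Rightarrow> bit"

definition multilinear :: "'a::ab_group_add family \<Rightarrow> bool" where
  "multilinear F \<longleftrightarrow>
    (\<forall>as m bs n i x y. i < length as \<longrightarrow>
      F (as[i := x + y]) m bs n = F (as[i := x]) m bs n + F (as[i := y]) m bs n) \<and>
    (\<forall>as x y bs n. F as (x + y) bs n = F as x bs n + F as y bs n) \<and>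
    (\<forall>as m bs n i x y. i < length bs \<longrightarrow>
      F as m (bs[i := x + y]) n = F as m (bs[i := x]) n + F as m (bs[i := y]) n) \<and>
    (\<forall>as m bs x y. F as m bs (x + y) = F as m bs x + F as m bs y)"

text \<open>Positions are counted from \<open>0\<close>: the entries at \<open>j\<close> and \<open>j + 1\<close> are replaced by their product.\<close>

definition merge_at :: "nat \<Rightarrow> 'a::times list \<Rightarrow> 'a list" where
  "merge_at j xs = take j xs @ [xs ! j * xs ! Suc j] @ drop (Suc (Suc j)) xs"

definition D_op :: "'a::dg_algebra family \<Rightarrow> 'a family" where
  "D_op F = (\<lambda>as m bs n.
      (\<Sum>i<length as. F (as[i := differential (as ! i)]) m bs n)
    + F as (differential m) bs n
    + (\<Sum>i<length bs. F as m (bs[i := differential (bs ! i)]) n)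
    + F as m bs (differential n)
    + (if as = [] then 0 else
         F (tl as) m bs (n * hd as)
         + (\<Sum>j<length as - 1. F (merge_at j as) m bs n)
         + F (butlast as) (last as * m) bs n)
    + (if bs = [] then 0 else
         F as (m * hd bs) (tl bs) n
         + (\<Sum>j<length bs - 1. F as m (merge_at j bs) n)
         + F as m (butlast bs) (last bs * n)))"

section \<open>The simplicial cochain algebra of the 2-simplex\<close>

datatype simplex = E0 | E1 | E2 | B01 | B02 | B12 | C012

lemma UNIV_simplex: "UNIV = {E0, E1, E2, B01, B02, B12, C012}"
  using simplex.exhaust by auto

instance simplex :: finite
  by standard (simp add: UNIV_simplex)

fun simplex_degree :: "simplex \<Rightarrow> int" where
  "simplex_degree E0 = 0"
| "simplex_degree E1 = 0"
| "simplex_degree E2 = 0"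
| "simplex_degree B01 = -1"
| "simplex_degree B02 = -1"
| "simplex_degree B12 = -1"
| "simplex_degree C012 = -2"

text \<open>The set of basis elements whose sum is the differential of the given one.\<close>

fun simplex_differential :: "simplex \<Rightarrow> simplex set" where
  "simplex_differential E0 = {B01, B02}"
| "simplex_differential E1 = {B01, B12}"
| "simplex_differential E2 = {B02, B12}"
| "simplex_differential B01 = {C012}"
| "simplex_differential B02 = {C012}"
| "simplex_differential B12 = {C012}"
| "simplex_differential C012 = {}"

text \<open>A product of two basis elements is again a basis element or zero (\<^term>\<open>None\<close>).\<close>

fun simplex_mult :: "simplex \<Rightarrow> simplex \<Rightarrow> simplex option" where
  "simplex_mult E0 E0 = Some E0"
| "simplex_mult E1 E1 = Some E1"
| "simplex_mult E2 E2 = Some E2"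
| "simplex_mult E0 B01 = Some B01"
| "simplex_mult B01 E1 = Some B01"
| "simplex_mult E0 B02 = Some B02"
| "simplex_mult B02 E2 = Some B02"
| "simplex_mult E1 B12 = Some B12"
| "simplex_mult B12 E2 = Some B12"
| "simplex_mult E0 C012 = Some C012"
| "simplex_mult C012 E2 = Some C012"
| "simplex_mult B01 B12 = Some C012"
| "simplex_mult _ _ = None"

lemma simplex_degree_mult:
  "simplex_mult u v = Some w \<Longrightarrow> simplex_degree w = simplex_degree u + simplex_degree v"
  by (cases u; cases v) auto

lemma simplex_degree_differential:
  "w \<in> simplex_differential u \<Longrightarrow> simplex_degree w = simplex_degree u - 1"
  by (cases u) auto

typedef cochain = "UNIV :: (simplex \<Rightarrow> bit) set"
  morphisms coeff Cochain
  by simp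

lemma cochain_eq_iff: "x = y \<longleftrightarrow> (\<forall>u. coeff x u = coeff y u)"
  by (metis coeff_inject ext)

lemma coeff_Cochain [simp]: "coeff (Cochain f) = f"
  by (simp add: Cochain_inverse)

lemma all_simplex:
  "(\<forall>u. P u) \<longleftrightarrow> P E0 \<and> P E1 \<and> P E2 \<and> P B01 \<and> P B02 \<and> P B12 \<and> P C012"
  by (metis simplex.exhaust)

lemma sum_simplex:
  fixes f :: "simplex \<Rightarrow> 'b::comm_monoid_add"
  shows "(\<Sum>u\<in>UNIV. f u) = f E0 + f E1 + f E2 + f B01 + f B02 + f B12 + f C012"
  by (simp add: UNIV_simplex add.assoc)

instantiation cochain :: "{ring, monoid_mult}"
begin

definition "0 = Cochain (\<lambda>u. 0)"
definition "x + y = Cochain (\<lambda>u. coeff x u + coeff y u)"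
definition "- x = Cochain (\<lambda>u. - coeff x u)"
definition "x - y = Cochain (\<lambda>u. coeff x u - coeff y u)"
definition "1 = Cochain (\<lambda>u. if u \<in> {E0, E1, E2} then 1 else 0)"
definition "x * y =
  Cochain (\<lambda>w. \<Sum>u\<in>UNIV. \<Sum>v\<in>UNIV. if simplex_mult u v = Some w then coeff x u * coeff y v else 0)"

lemma coeff_linear:
  "coeff 0 u = 0"
  "coeff (x + y) u = coeff x u + coeff y u"
  "coeff (- x) u = - coeff x u"
  "coeff (x - y) u = coeff x u - coeff y u"
  by (simp_all add: zero_cochain_def plus_cochain_def uminus_cochain_def minus_cochain_def)

lemma coeff_one:
  "coeff 1 u = (if u \<in> {E0, E1, E2} then 1 else 0)"
  by (simp add: one_cochain_def)

lemma coeff_mult: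
  "coeff (x * y) E0 = coeff x E0 * coeff y E0"
  "coeff (x * y) E1 = coeff x E1 * coeff y E1"
  "coeff (x * y) E2 = coeff x E2 * coeff y E2"
  "coeff (x * y) B01 = coeff x E0 * coeff y B01 + coeff x B01 * coeff y E1"
  "coeff (x * y) B02 = coeff x E0 * coeff y B02 + coeff x B02 * coeff y E2"
  "coeff (x * y) B12 = coeff x E1 * coeff y B12 + coeff x B12 * coeff y E2"
  "coeff (x * y) C012 =
     coeff x E0 * coeff y C012 + coeff x B01 * coeff y B12 + coeff x C012 * coeff y E2"
  by (simp_all only: times_cochain_def coeff_Cochain sum_simplex simplex_mult.simps option.inject
      option.distinct simplex.distinct if_True if_False simp_thms add_0_left add_0_right)

instance
proof
  fix x y z :: cochain
  show "- x + x = 0"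
    unfolding cochain_eq_iff coeff_linear by (intro allI left_minus)
  show "x + y + z = x + (y + z)" "x + y = y + x" "0 + x = x" "x - y = x + - y"
    by (simp_all only: cochain_eq_iff coeff_linear ac_simps add_0_left
        diff_conv_add_uminus simp_thms)
  show "x * y * z = x * (y * z)" "(x + y) * z = x * z + y * z" "x * (y + z) = x * y + x * z"
    by (simp_all only: cochain_eq_iff all_simplex coeff_linear coeff_mult distrib_left distrib_right
        ac_simps simp_thms)
  show "1 * x = x" "x * 1 = x"
    by (simp_all only: cochain_eq_iff all_simplex coeff_one coeff_mult insert_iff empty_iff
        simplex.distinct if_True if_False simp_thms mult_1_left mult_1_right mult_zero_left
        mult_zero_right add_0_left add_0_right)
qed

end

lemma coeff_sum: "coeff (sum f S) u = (\<Sum>i\<in>S. coeff (f i) u)"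
  by (induction S rule: infinite_finite_induct) (simp_all only: sum.infinite sum.empty sum.insert
      coeff_linear not_False_eq_True)

instantiation cochain :: dg_algebra
begin

definition "differential x =
  Cochain (\<lambda>w. \<Sum>u\<in>UNIV. if w \<in> simplex_differential u then coeff x u else 0)"
definition "homogeneous i = {x. \<forall>u. coeff x u \<noteq> 0 \<longrightarrow> simplex_degree u = i}"

lemma coeff_differential:
  "coeff (differential x) E0 = 0"
  "coeff (differential x) E1 = 0"
  "coeff (differential x) E2 = 0"
  "coeff (differential x) B01 = coeff x E0 + coeff x E1"
  "coeff (differential x) B02 = coeff x E0 + coeff x E2"
  "coeff (differential x) B12 = coeff x E1 + coeff x E2"
  "coeff (differential x) C012 = coeff x B01 + coeff x B02 + coeff x B12"
  by (simp_all only: differential_cochain_def coeff_Cochain sum_simplex simplex_differential.simps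
      insert_iff empty_iff simplex.distinct if_True if_False simp_thms add_0_left add_0_right)

lemma mem_homogeneous:
  "x \<in> homogeneous i \<longleftrightarrow> (\<forall>u. coeff x u \<noteq> 0 \<longrightarrow> simplex_degree u = i)"
  by (simp add: homogeneous_cochain_def)

lemma bit_cancel: "a + a = 0" "a + (a + b) = b" for a b :: bit
  by (cases a; cases b; simp)+

lemma coeff_sum_homogeneous:
  assumes "\<forall>i. f i \<in> homogeneous i" and "finite {i. f i \<noteq> 0}"
  shows "coeff (sum f {i. f i \<noteq> 0}) u = coeff (f (simplex_degree u)) u"
proof -
  have "coeff (f i) u = (if i = simplex_degree u then coeff (f i) u else 0)" for i
    using assms(1) unfolding mem_homogeneous by metis
  then have "(\<Sum>i | f i \<noteq> 0. coeff (f i) u) =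
      (\<Sum>i | f i \<noteq> 0. if i = simplex_degree u then coeff (f i) u else 0)"
    by (intro sum.cong) auto
  also have "\<dots> = coeff (f (simplex_degree u)) u"
    using assms(2) by (subst sum.delta) (auto simp: coeff_linear)
  finally show ?thesis
    by (simp only: coeff_sum)
qed

instance
proof
  fix x y z :: cochain and i j :: int
  show "x + x = 0"
    by (simp add: cochain_eq_iff coeff_linear)
  show "0 \<in> (homogeneous i :: cochain set)"
    by (simp add: mem_homogeneous coeff_linear)
  show "x + y \<in> homogeneous i" if "x \<in> homogeneous i" "y \<in> homogeneous i"
    using that unfolding mem_homogeneous coeff_linear by (metis add_0_left)
  show "1 \<in> (homogeneous 0 :: cochain set)"
    by (auto simp: mem_homogeneous coeff_one all_simplex)
  show "x * y \<in> homogeneous (i + j)" if "x \<in> homogeneous i" "y \<in> homogeneous j"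
  proof (unfold mem_homogeneous, intro allI impI)
    fix w
    assume "coeff (x * y) w \<noteq> 0"
    then obtain u v where
        "(if simplex_mult u v = Some w then coeff x u * coeff y v else 0) \<noteq> 0"
      unfolding times_cochain_def coeff_Cochain
      by (elim sum.not_neutral_contains_not_neutral)
    then have "simplex_mult u v = Some w" "coeff x u \<noteq> 0" "coeff y v \<noteq> 0"
      by (auto split: if_splits)
    with that show "simplex_degree w = i + j"
      unfolding mem_homogeneous by (metis simplex_degree_mult)
  qed
  show "differential x \<in> homogeneous (i - 1)" if "x \<in> homogeneous i"
  proof (unfold mem_homogeneous, intro allI impI)
    fix w
    assume "coeff (differential x) w \<noteq> 0"
    then obtain u where "(if w \<in> simplex_differential u then coeff x u else 0) \<noteq> 0"
      unfolding differential_cochain_def coeff_Cochain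
      by (elim sum.not_neutral_contains_not_neutral)
    then have "w \<in> simplex_differential u" "coeff x u \<noteq> 0"
      by (auto split: if_splits)
    with that show "simplex_degree w = i - 1"
      unfolding mem_homogeneous by (metis simplex_degree_differential)
  qed
  show "differential (x + y) = differential x + differential y"
    by (simp_all only: cochain_eq_iff all_simplex coeff_linear coeff_differential ac_simps
        add_0_left simp_thms)
  show "differential (differential x) = 0"
    unfolding cochain_eq_iff all_simplex coeff_linear coeff_differential
    by (cases "coeff x E0"; cases "coeff x E1"; cases "coeff x E2") simp_all
  show "differential (x * y) = differential x * y + x * differential y"
    unfolding cochain_eq_iff all_simplex coeff_linear coeff_differential coeff_mult
    by (simp_all only: distrib_left distrib_right ac_simps bit_cancel mult_zero_left mult_zero_right
        add_0_left add_0_right simp_thms)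
  show "\<exists>!f. (\<forall>i. f i \<in> homogeneous i) \<and> finite {i. f i \<noteq> 0} \<and> x = sum f {i. f i \<noteq> 0}"
  proof (rule ex1I)
    let ?p = "\<lambda>i. Cochain (\<lambda>u. if simplex_degree u = i then coeff x u else 0)"
    have hom: "\<forall>i. ?p i \<in> homogeneous i"
      by (simp add: mem_homogeneous)
    have "{i. ?p i \<noteq> 0} \<subseteq> range simplex_degree"
      by (auto simp: cochain_eq_iff coeff_linear split: if_splits)
    then have fin: "finite {i. ?p i \<noteq> 0}"
      by (rule finite_subset) simp
    have "x = sum ?p {i. ?p i \<noteq> 0}"
      unfolding cochain_eq_iff[of x] coeff_sum_homogeneous[OF hom fin] by simp
    with hom fin show "(\<forall>i. ?p i \<in> homogeneous i) \<and> finite {i. ?p i \<noteq> 0} \<and> x = sum ?p {i. ?p i \<noteq> 0}"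
      by blast
    fix f :: "int \<Rightarrow> cochain"
    assume f: "(\<forall>i. f i \<in> homogeneous i) \<and> finite {i. f i \<noteq> 0} \<and> x = sum f {i. f i \<noteq> 0}"
    then have x: "coeff x u = coeff (f (simplex_degree u)) u" for u
      using coeff_sum_homogeneous[of f u] by metis
    show "f = ?p"
    proof (intro ext)
      fix i
      have "coeff (f i) u = coeff (?p i) u" for u
        using f x[of u] unfolding mem_homogeneous coeff_Cochain by metis
      then show "f i = ?p i"
        by (simp add: cochain_eq_iff)
    qed
  qed
qed

end

definition basis :: "simplex \<Rightarrow> cochain" where
  "basis u = Cochain (\<lambda>v. if v = u then 1 else 0)"

lemma coeff_basis [simp]: "coeff (basis u) v = (if v = u then 1 else 0)"
  by (simp add: basis_def)

lemma cochain_eq_sum_basis: "x = sum basis {u. coeff x u = 1}"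
  by (simp only: cochain_eq_iff coeff_sum) simp

lemma differential_basis: "differential (basis u) = sum basis (simplex_differential u)"
  by (cases u; simp only: cochain_eq_iff all_simplex coeff_differential coeff_sum; simp)

lemma mult_basis:
  "basis u * basis v = (case simplex_mult u v of None \<Rightarrow> 0 | Some w \<Rightarrow> basis w)"
  by (cases u; cases v; simp only: cochain_eq_iff all_simplex coeff_mult; simp add: coeff_linear)

lemma one_eq_sum_basis: "1 = basis E0 + basis E1 + basis E2"
  by (simp only: cochain_eq_iff all_simplex coeff_linear coeff_one; simp)

section \<open>The families attached to the edges and to the triangle\<close>

definition multilinear_extension ::
    "(simplex list \<Rightarrow> simplex \<Rightarrow> simplex list \<Rightarrow> simplex \<Rightarrow> bool) \<Rightarrow> cochain family" where
  "multilinear_extension P = (\<lambda>as m bs n.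
    \<Sum>us | length us = length as. \<Sum>u\<in>UNIV. \<Sum>vs | length vs = length bs. \<Sum>v\<in>UNIV.
      of_bool (P us u vs v)
      * (\<Prod>i<length as. coeff (as ! i) (us ! i)) * coeff m u
      * (\<Prod>i<length bs. coeff (bs ! i) (vs ! i)) * coeff n v)"

lemma finite_simplex_lists: "finite {us :: simplex list. length us = k}"
  using finite_lists_length_eq[of "UNIV :: simplex set" k] by simp

lemma prod_coeff_basis:
  assumes "length us = length ws"
  shows "(\<Prod>i<length ws. coeff (map basis ws ! i) (us ! i)) = of_bool (us = ws)"
proof (cases "us = ws")
  case True
  then show ?thesis by simp
next
  case False
  then obtain i where "i < length ws" "us ! i \<noteq> ws ! i"
    using assms by (metis nth_equalityI)
  then show ?thesis
    using False by (auto intro!: prod_zero bexI[of _ i])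
qed

lemma multilinear_extension_basis:
  "multilinear_extension P (map basis us) (basis u) (map basis vs) (basis v) = of_bool (P us u vs v)"
proof -
  have "multilinear_extension P (map basis us) (basis u) (map basis vs) (basis v) =
    (\<Sum>us' | length us' = length us. \<Sum>u'\<in>UNIV. \<Sum>vs' | length vs' = length vs. \<Sum>v'\<in>UNIV.
      if v' = v then if vs' = vs then if u' = u then if us' = us
        then of_bool (P us u vs v) else 0 else 0 else 0 else 0)"
    unfolding multilinear_extension_def length_map
    by (intro sum.cong refl; simp only: mem_Collect_eq prod_coeff_basis coeff_basis; simp)
  also have "\<dots> = of_bool (P us u vs v)"
    by (simp add: finite_simplex_lists)
  finally show ?thesis .
qed

lemma prod_coeff_update:
  assumes "i < length as"
  shows "(\<Prod>k<length as. coeff (as[i := x] ! k) (us ! k)) =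
    coeff x (us ! i) * (\<Prod>k\<in>{..<length as} - {i}. coeff (as ! k) (us ! k))"
  using assms by (subst prod.remove[of _ i]) (auto intro!: prod.cong)

lemma multilinear_multilinear_extension: "multilinear (multilinear_extension P)"
  unfolding multilinear_def multilinear_extension_def
  by (intro conjI allI impI; simp only: prod_coeff_update length_list_update coeff_linear
      distrib_left distrib_right sum.distrib)

text \<open>
  \<open>edge_value u b v\<close> lists the non-zero values on basis elements for the edge \<open>b\<close> with initial
  vertex \<open>u\<close> and final vertex \<open>v\<close>. The argument \<open>bs\<close> is empty because only components with \<open>q = 0\<close>
  are non-zero.
\<close>

definition edge_value ::
    "simplex \<Rightarrow> simplex \<Rightarrow> simplex \<Rightarrow> simplex list \<Rightarrow> simplex \<Rightarrow> simplex list \<Rightarrow> simplex \<Rightarrow> bool" where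
  "edge_value u b v as m bs n \<longleftrightarrow>
    bs = [] \<and> (\<exists>k. as = replicate k b) \<and> (m, n) \<in> {(u, b), (b, v)}"

definition triangle_value ::
    "simplex list \<Rightarrow> simplex \<Rightarrow> simplex list \<Rightarrow> simplex \<Rightarrow> bool" where
  "triangle_value as m bs n \<longleftrightarrow> bs = [] \<and>
    ((\<exists>k. as = replicate k B02 \<and> (m, n) \<in> {(C012, E2), (E0, C012), (B01, B12)})
   \<or> (\<exists>k l. 1 \<le> l \<and> l \<le> k + 1 \<and>
        as = replicate (l - 1) B01 @ [C012] @ replicate (k + 1 - l) B02 \<and>
        (m, n) \<in> {(E0, B01), (B01, E1)})
   \<or> (\<exists>k l. 1 \<le> l \<and> l \<le> k + 1 \<and>
        as = replicate (l - 1) B02 @ [C012] @ replicate (k + 1 - l) B12 \<and>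
        (m, n) \<in> {(E1, B12), (B12, E2)})
   \<or> (\<exists>k l1 l2. 1 \<le> l1 \<and> l1 < l2 \<and> l2 \<le> k + 2 \<and>
        as = replicate (l1 - 1) B01 @ [C012] @ replicate (l2 - l1 - 1) B02 @ [C012]
             @ replicate (k + 2 - l2) B12 \<and>
        (m, n) = (E1, E1)))"

definition F01 :: "cochain family" where
  "F01 = multilinear_extension (edge_value E0 B01 E1)"

definition F02 :: "cochain family" where
  "F02 = multilinear_extension (edge_value E0 B02 E2)"

definition F12 :: "cochain family" where
  "F12 = multilinear_extension (edge_value E1 B12 E2)"

definition F012 :: "cochain family" where
  "F012 = multilinear_extension triangle_value"

end

theory Submission
  imports Defs
begin

text \<open>
  For a cochain \<open>a\<close> with coefficients \<open>a\<^sub>u\<close> let \<open>M(a)\<close> be the upper triangular \<open>3 \<times> 3\<close> matrix with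
  diagonal \<open>(a\<^sub>0\<^sub>1, a\<^sub>0\<^sub>2, a\<^sub>1\<^sub>2)\<close>, both superdiagonal entries \<open>a\<^sub>0\<^sub>1\<^sub>2\<close> and corner \<open>0\<close>. The entries of
  \<open>T = M(a\<^sub>1) \<cdots> M(a\<^sub>p)\<close> count the words that occur in the four families (the corner entry, for
  instance, those of the form \<open>b\<^sub>0\<^sub>1\<cdots>b\<^sub>0\<^sub>1 c b\<^sub>0\<^sub>2\<cdots>b\<^sub>0\<^sub>2 c b\<^sub>1\<^sub>2\<cdots>b\<^sub>1\<^sub>2\<close>), so every family is a linear form
  in \<open>T\<close> with coefficients bilinear in \<open>m\<close> and \<open>n\<close>. With suitable matrices \<open>P(a)\<close>, \<open>Q(a)\<close> and the
  nilpotent Jordan block \<open>N\<close> one has \<open>M(ab) = P(a) M(b) + M(a) Q(b)\<close> and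
  \<open>M(da) = P(a) + Q(a) + [N, M(a)]\<close>. Hence the sum of all terms of the operator that differentiate
  some \<open>a\<^sub>i\<close> or multiply two neighbours \<open>a\<^sub>j\<close>, \<open>a\<^sub>j\<^sub>+\<^sub>1\<close> telescopes to
  \<open>Q(a\<^sub>1) M(a\<^sub>2) \<cdots> M(a\<^sub>p) + M(a\<^sub>1) \<cdots> M(a\<^sub>p\<^sub>-\<^sub>1) P(a\<^sub>p) + [N, T]\<close>, and what is left is a comparison
  of finitely many coefficients.
\<close>

section \<open>Telescoping\<close>

lemma merge_at_Cons_Suc: "merge_at (Suc j) (x # xs) = x # merge_at j xs"
  by (simp add: merge_at_def)

text \<open>Expanding \<open>M (a * b)\<close> at each merge puts \<open>P\<close> in all slots but
  the last and \<open>Q\<close> in all slots but the first; these cancel the \<open>P\<close> and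
  \<open>Q\<close> from \<open>M_differential\<close>. The commutator with \<open>N\<close> is a
  derivation, so its contributions add up to the commutator with the whole product.\<close>

lemma prod_list_telescope:
  fixes M P Q :: "'a::dg_algebra \<Rightarrow> 'b::{ring, monoid_mult}"
  assumes char_two: "\<And>x::'b. x + x = 0"
    and M_mult: "\<And>a b. M (a * b) = P a * M b + M a * Q b"
    and M_differential: "\<And>a. M (differential a) = P a + Q a + (N * M a + M a * N)"
    and "as \<noteq> []"
  shows "(\<Sum>i<length as. prod_list (map M (as[i := differential (as ! i)])))
      + (\<Sum>j<length as - 1. prod_list (map M (merge_at j as)))
    = Q (hd as) * prod_list (map M (tl as)) + prod_list (map M (butlast as)) * P (last as)
      + (N * prod_list (map M as) + prod_list (map M as) * N)"
  using \<open>as \<noteq> []\<close>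
proof (induction as rule: induct_list012)
  case 1
  then show ?case by simp
next
  case (2 a)
  then show ?case by (simp add: M_differential ac_simps)
next
  case (3 a b cs)
  have cancel: "x + (x + y) = y" for x y :: 'b
    by (simp add: char_two flip: add.assoc)
  let ?S = "\<lambda>as. \<Sum>i<length as. prod_list (map M (as[i := differential (as ! i)]))"
  let ?R = "\<lambda>as. \<Sum>j<length as - 1. prod_list (map M (merge_at j as))"
  let ?T = "\<lambda>as. prod_list (map M as)"
  have S: "?S (a # b # cs) = M (differential a) * ?T (b # cs) + M a * ?S (b # cs)"
    unfolding list.size sum.lessThan_Suc_shift add_Suc_right add_0_right
    by (simp add: sum_distrib_left distrib_left mult.assoc)
  have R: "?R (a # b # cs) = M (a * b) * ?T cs + M a * ?R (b # cs)"
    by (simp add: sum.lessThan_Suc_shift sum_distrib_left merge_at_Cons_Suc del: sum.lessThan_Suc)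
      (simp add: merge_at_def)
  have IH: "?S (b # cs) + ?R (b # cs) =
      Q b * ?T cs + ?T (butlast (b # cs)) * P (last (b # cs))
      + (N * ?T (b # cs) + ?T (b # cs) * N)"
    using "3.IH"(2) by simp
  have "?S (a # b # cs) + ?R (a # b # cs) =
      M (differential a) * ?T (b # cs) + M (a * b) * ?T cs
      + M a * (?S (b # cs) + ?R (b # cs))"
    unfolding S R by (simp only: distrib_left ac_simps)
  \<comment> \<open>Three terms occur twice and cancel: those starting with
    \<open>P a * M b\<close>, \<open>M a * Q b\<close> and \<open>M a * N\<close>.\<close>
  also have "\<dots> = Q a * ?T (b # cs) + M a * ?T (butlast (b # cs)) * P (last (b # cs))
      + (N * ?T (a # b # cs) + ?T (a # b # cs) * N)"
    unfolding IH M_mult M_differential list.map prod_list.Cons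
    by (simp only: distrib_left distrib_right mult.assoc ac_simps(1-3) cancel char_two add_0_right)
  finally show ?case
    by (simp add: mult.assoc)
qed

section \<open>Upper triangular matrices\<close>

datatype upper = Upper (e00: bit) (e01: bit) (e02: bit) (e11: bit) (e12: bit) (e22: bit)

lemma upper_eq_iff:
  "X = Y \<longleftrightarrow> e00 X = e00 Y \<and> e01 X = e01 Y \<and> e02 X = e02 Y
    \<and> e11 X = e11 Y \<and> e12 X = e12 Y \<and> e22 X = e22 Y"
  by (auto intro: upper.expand)

instantiation upper :: "{ring, monoid_mult}"
begin

definition "0 = Upper 0 0 0 0 0 0"
definition "X + Y = Upper (e00 X + e00 Y) (e01 X + e01 Y) (e02 X + e02 Y)
  (e11 X + e11 Y) (e12 X + e12 Y) (e22 X + e22 Y)"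
definition "- X = (X :: upper)"
definition "X - Y = (X + Y :: upper)"
definition "1 = Upper 1 0 0 1 0 1"
definition "X * Y = Upper (e00 X * e00 Y) (e00 X * e01 Y + e01 X * e11 Y)
  (e00 X * e02 Y + e01 X * e12 Y + e02 X * e22 Y)
  (e11 X * e11 Y) (e11 X * e12 Y + e12 X * e22 Y) (e22 X * e22 Y)"

lemmas upper_ring_defs =
  zero_upper_def plus_upper_def uminus_upper_def minus_upper_def one_upper_def times_upper_def

instance
  by standard
    (simp_all only: upper_ring_defs upper_eq_iff upper.sel distrib_left distrib_right
      ac_simps add_0_left add_0_right mult_1_left mult_1_right mult_zero_left mult_zero_right
      bit_cancel simp_thms)

end

lemma upper_char_two: "X + X = 0" for X :: upper
  by (simp only: upper_ring_defs bit_cancel)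

text \<open>Transfer matrix of an automaton with states B01, B02, B12 in this order: the letter of
  the current state keeps it, C012 advances by one state.\<close>

definition word_matrix :: "cochain \<Rightarrow> upper" where
  "word_matrix a = Upper (coeff a B01) (coeff a C012) 0 (coeff a B02) (coeff a C012) (coeff a B12)"

text \<open>The product of B01 and B12 contributes to both superdiagonal entries of
  \<open>word_matrix (a * b)\<close>: to the upper one through \<open>right_matrix b\<close>, to the
  lower one through \<open>left_matrix a\<close>.\<close>

definition left_matrix :: "cochain \<Rightarrow> upper" where
  "left_matrix a = Upper (coeff a E0) 0 0 (coeff a E0) (coeff a B01) (coeff a E1)"

definition right_matrix :: "cochain \<Rightarrow> upper" where
  "right_matrix a = Upper (coeff a E1) (coeff a B12) 0 (coeff a E2) 0 (coeff a E2)"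

definition jordan_block :: upper where
  "jordan_block = Upper 0 1 0 0 1 0"

lemmas matrix_defs = word_matrix_def left_matrix_def right_matrix_def jordan_block_def

lemmas bit_ring_simps = distrib_left distrib_right ac_simps bit_cancel add_0_left add_0_right
  mult_1_left mult_1_right mult_zero_left mult_zero_right simp_thms

lemma word_matrix_mult:
  "word_matrix (a * b) = left_matrix a * word_matrix b + word_matrix a * right_matrix b"
  by (simp only: upper_ring_defs upper_eq_iff upper.sel matrix_defs coeff_mult bit_ring_simps)

text \<open>On the superdiagonal the commutator adds the sums of neighbouring diagonal entries that
  complete the C012 coefficient; in the corner it vanishes because the superdiagonal entries
  agree.\<close>

lemma word_matrix_differential:
  "word_matrix (differential a) = left_matrix a + right_matrix a
    + (jordan_block * word_matrix a + word_matrix a * jordan_block)"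
  by (simp only: upper_ring_defs upper_eq_iff upper.sel matrix_defs coeff_differential
      bit_ring_simps)

section \<open>The linear form of the triangle\<close>

abbreviation word_product :: "cochain list \<Rightarrow> upper" where
  "word_product as \<equiv> prod_list (map word_matrix as)"

text \<open>The factors in parentheses are the coefficients of \<open>m * n\<close> at C012, B01,
  B12 and E1.\<close>

definition triangle_form :: "cochain \<Rightarrow> cochain \<Rightarrow> upper \<Rightarrow> bit" where
  "triangle_form m n X =
      e11 X * (coeff m C012 * coeff n E2 + coeff m E0 * coeff n C012 + coeff m B01 * coeff n B12)
    + e01 X * (coeff m E0 * coeff n B01 + coeff m B01 * coeff n E1)
    + e12 X * (coeff m E1 * coeff n B12 + coeff m B12 * coeff n E2)
    + e02 X * (coeff m E1 * coeff n E1)"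

lemma triangle_form_add: "triangle_form m n (X + Y) = triangle_form m n X + triangle_form m n Y"
  by (simp only: triangle_form_def upper_ring_defs upper.sel bit_ring_simps)

lemma triangle_form_sum: "triangle_form m n (sum f S) = (\<Sum>i\<in>S. triangle_form m n (f i))"
proof -
  have "triangle_form m n 0 = 0"
    by (simp only: triangle_form_def upper_ring_defs upper.sel bit_ring_simps)
  then show ?thesis
    by (induction S rule: infinite_finite_induct)
      (simp_all only: sum.infinite sum.empty sum.insert triangle_form_add not_False_eq_True)
qed

text \<open>Pairs the left end term of the telescoped sum with the term of \<open>D_op\<close> that
  multiplies \<open>n\<close> by the first input; they agree up to one E0 remainder. The next lemma
  does the same at the right end, with an E2 remainder.\<close>

lemma triangle_form_right_matrix:
  "triangle_form m n (right_matrix a * X) + triangle_form m (n * a) X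
    = e01 (word_matrix a * X) * (coeff m E0 * coeff n E0)"
  by (simp only: triangle_form_def upper_ring_defs upper.sel matrix_defs coeff_mult bit_ring_simps)

lemma triangle_form_left_matrix:
  "triangle_form m n (X * left_matrix a) + triangle_form (a * m) n X
    = e12 (X * word_matrix a) * (coeff m E2 * coeff n E2)"
  by (simp only: triangle_form_def upper_ring_defs upper.sel matrix_defs coeff_mult bit_ring_simps)

text \<open>The final comparison: differentials of \<open>m\<close> and \<open>n\<close>, commutator
  and both end remainders leave exactly the three edge families.\<close>

lemma triangle_form_differential:
  "triangle_form (differential m) n X + triangle_form m (differential n) X
      + triangle_form m n (jordan_block * X + X * jordan_block)
      + e01 X * (coeff m E0 * coeff n E0) + e12 X * (coeff m E2 * coeff n E2)
    = e00 X * (coeff m E0 * coeff n B01 + coeff m B01 * coeff n E1)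
      + e11 X * (coeff m E0 * coeff n B02 + coeff m B02 * coeff n E2)
      + e22 X * (coeff m E1 * coeff n B12 + coeff m B12 * coeff n E2)"
  by (simp only: triangle_form_def upper_ring_defs upper.sel matrix_defs coeff_differential
      bit_ring_simps)

text \<open>The form depends on \<open>m\<close> and \<open>n\<close> only through
  \<open>m * n\<close>, so this is associativity.\<close>

lemma triangle_form_mult_middle: "triangle_form (m * b) n X = triangle_form m (b * n) X"
  by (simp only: triangle_form_def coeff_mult bit_ring_simps)

section \<open>The families as matrix entries\<close>

definition word_sum :: "(simplex list \<Rightarrow> bool) \<Rightarrow> cochain list \<Rightarrow> bit" where
  "word_sum R as =
    (\<Sum>us | length us = length as. of_bool (R us) * (\<Prod>i<length as. coeff (as ! i) (us ! i)))"

lemma word_sum_False: "word_sum (\<lambda>us. False) as = 0"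
  by (simp add: word_sum_def)

lemma word_sum_Nil: "word_sum R [] = of_bool (R [])"
  by (simp add: word_sum_def)

lemma word_sum_Cons:
  "word_sum R (a # as) = (\<Sum>u\<in>UNIV. coeff a u * word_sum (\<lambda>us. R (u # us)) as)"
proof -
  have lists: "{us :: simplex list. length us = length (a # as)} =
      (\<lambda>(u, us). u # us) ` (UNIV \<times> {us. length us = length as})"
    by (auto simp: length_Suc_conv image_iff)
  have inj: "inj_on (\<lambda>(u, us). u # us) (UNIV \<times> {us :: simplex list. length us = length as})"
    by (auto simp: inj_on_def)
  show ?thesis
    unfolding word_sum_def lists sum.reindex[OF inj] sum_distrib_left sum.cartesian_product
    by (intro sum.cong) (auto simp: prod.lessThan_Suc_shift simp del: prod.lessThan_Suc)
qed

text \<open>Recursion replaces the positions of C012, so that words can be read letter by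
  letter.\<close>

fun block_word :: "simplex list \<Rightarrow> simplex list \<Rightarrow> bool" where
  "block_word [] us \<longleftrightarrow> False"
| "block_word [b] us \<longleftrightarrow> (\<exists>k. us = replicate k b)"
| "block_word (b # b' # bs) us \<longleftrightarrow>
    (\<exists>k ws. us = replicate k b @ C012 # ws \<and> block_word (b' # bs) ws)"

lemma block_word_Nil:
  "block_word [b] []" "\<not> block_word (b # b' # bs) []"
  by simp_all

lemma block_word_Cons:
  "block_word [b] (u # us) \<longleftrightarrow> u = b \<and> block_word [b] us"
  "block_word (b # b' # bs) (u # us) \<longleftrightarrow>
    u = b \<and> block_word (b # b' # bs) us \<or> u = C012 \<and> block_word (b' # bs) us"
proof -
  have split: "(\<exists>k. Q k) \<longleftrightarrow> Q 0 \<or> (\<exists>k. Q (Suc k))" for Q :: "nat \<Rightarrow> bool"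
    by (metis not0_implies_Suc)
  show "block_word [b] (u # us) \<longleftrightarrow> u = b \<and> block_word [b] us"
    unfolding block_word.simps by (subst split) auto
  show "block_word (b # b' # bs) (u # us) \<longleftrightarrow>
    u = b \<and> block_word (b # b' # bs) us \<or> u = C012 \<and> block_word (b' # bs) us"
    unfolding block_word.simps by (subst split) auto
qed

text \<open>All entries are treated together because reading C012 passes to the entry of a shorter
  block list.\<close>

lemma word_sum_block_word:
  "word_sum (block_word [B01]) as = e00 (word_product as)
   \<and> word_sum (block_word [B01, B02]) as = e01 (word_product as)
   \<and> word_sum (block_word [B01, B02, B12]) as = e02 (word_product as)
   \<and> word_sum (block_word [B02]) as = e11 (word_product as)
   \<and> word_sum (block_word [B02, B12]) as = e12 (word_product as)
   \<and> word_sum (block_word [B12]) as = e22 (word_product as)"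
proof (induction as)
  case Nil
  show ?case
    by (simp add: word_sum_Nil block_word_Nil one_upper_def del: block_word.simps)
next
  case (Cons a as)
  then show ?case
    by (simp add: word_sum_Cons sum_simplex block_word_Cons word_sum_False times_upper_def
        word_matrix_def ac_simps del: block_word.simps)
qed

lemma multilinear_extension_right_empty:
  assumes "\<forall>us u vs v. P us u vs v \<longrightarrow> vs = []"
  shows "multilinear_extension P as m bs n = (if bs = [] then
    \<Sum>u\<in>UNIV. \<Sum>v\<in>UNIV. word_sum (\<lambda>us. P us u [] v) as * (coeff m u * coeff n v) else 0)"
proof (cases "bs = []")
  case True
  have "multilinear_extension P as m [] n = (\<Sum>us | length us = length as. \<Sum>u\<in>UNIV. \<Sum>v\<in>UNIV.
      of_bool (P us u [] v) * (\<Prod>i<length as. coeff (as ! i) (us ! i))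
      * (coeff m u * coeff n v))"
  proof -
    have empty: "{vs :: simplex list. length vs = 0} = {[]}"
      by auto
    show ?thesis
      by (simp only: multilinear_extension_def list.size empty sum.insert finite.emptyI sum.empty
          empty_iff not_False_eq_True lessThan_0 prod.empty mult_1_left mult_1_right mult.assoc
          add_0_right)
  qed
  also have "\<dots> = (\<Sum>u\<in>UNIV. \<Sum>us | length us = length as. \<Sum>v\<in>UNIV.
      of_bool (P us u [] v) * (\<Prod>i<length as. coeff (as ! i) (us ! i))
      * (coeff m u * coeff n v))"
    by (rule sum.swap)
  also have "\<dots> = (\<Sum>u\<in>UNIV. \<Sum>v\<in>UNIV. word_sum (\<lambda>us. P us u [] v) as * (coeff m u * coeff n v))"
    unfolding word_sum_def sum_distrib_right by (intro sum.cong refl sum.swap)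
  finally show ?thesis
    using True by simp
next
  case False
  have "\<not> P us u vs v" if "length vs = length bs" for us u vs v
    using assms that False by force
  then show ?thesis
    using False by (simp add: multilinear_extension_def)
qed

lemma edge_value_right_empty: "\<forall>us m vs n. edge_value u b v us m vs n \<longrightarrow> vs = []"
  by (simp add: edge_value_def)

lemma edge_value_iff:
  "edge_value u b v us m [] n \<longleftrightarrow> block_word [b] us \<and> (m, n) \<in> {(u, b), (b, v)}"
  by (simp add: edge_value_def)

lemma edge_families:
  "F01 as m bs n = (if bs = [] then e00 (word_product as)
    * (coeff m E0 * coeff n B01 + coeff m B01 * coeff n E1) else 0)"
  "F02 as m bs n = (if bs = [] then e11 (word_product as)
    * (coeff m E0 * coeff n B02 + coeff m B02 * coeff n E2) else 0)"
  "F12 as m bs n = (if bs = [] then e22 (word_product as)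
    * (coeff m E1 * coeff n B12 + coeff m B12 * coeff n E2) else 0)"
  unfolding F01_def F02_def F12_def
    multilinear_extension_right_empty[OF edge_value_right_empty]
    edge_value_iff sum_simplex
  by (simp_all add: word_sum_False word_sum_block_word distrib_left del: block_word.simps)

lemma triangle_value_right_empty: "\<forall>us m vs n. triangle_value us m vs n \<longrightarrow> vs = []"
  by (simp add: triangle_value_def)

lemma triangle_value_iff:
  "triangle_value us m [] n \<longleftrightarrow>
    block_word [B02] us \<and> (m, n) \<in> {(C012, E2), (E0, C012), (B01, B12)}
    \<or> block_word [B01, B02] us \<and> (m, n) \<in> {(E0, B01), (B01, E1)}
    \<or> block_word [B02, B12] us \<and> (m, n) \<in> {(E1, B12), (B12, E2)}
    \<or> block_word [B01, B02, B12] us \<and> (m, n) = (E1, E1)"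
proof -
  have one: "(\<exists>k l. 1 \<le> l \<and> l \<le> k + 1 \<and>
        us = replicate (l - 1) b @ [C012] @ replicate (k + 1 - l) b' \<and> Z)
      \<longleftrightarrow> block_word [b, b'] us \<and> Z" (is "?L \<longleftrightarrow> ?R") for b b' Z
  proof
    assume ?R
    then obtain i j where "us = replicate i b @ C012 # replicate j b'" "Z"
      by auto
    then show ?L
      \<comment> \<open>\<open>k\<close> counts the letters other than C012, and positions start at
        1.\<close>
      by (intro exI[of _ "i + j"] exI[of _ "i + 1"]) simp
  qed auto
  have three_blocks: "block_word [B01, B02, B12]
      (replicate i B01 @ C012 # replicate j B02 @ C012 # replicate k B12)" for i j k
    unfolding block_word.simps by blast
  have two: "(\<exists>k l1 l2. 1 \<le> l1 \<and> l1 < l2 \<and> l2 \<le> k + 2 \<and>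
        us = replicate (l1 - 1) B01 @ [C012] @ replicate (l2 - l1 - 1) B02 @ [C012]
             @ replicate (k + 2 - l2) B12 \<and> Z)
      \<longleftrightarrow> block_word [B01, B02, B12] us \<and> Z" (is "?L \<longleftrightarrow> ?R") for Z
  proof
    assume ?R
    then obtain i j k where
        "us = replicate i B01 @ C012 # replicate j B02 @ C012 # replicate k B12" "Z"
      by auto
    then show ?L
      by (intro exI[of _ "i + j + k"] exI[of _ "i + 1"] exI[of _ "i + j + 2"]) simp
  qed (use three_blocks in \<open>auto simp del: block_word.simps\<close>)
  show ?thesis
    unfolding triangle_value_def one two by simp
qed

lemma triangle_family:
  "F012 as m bs n = (if bs = [] then triangle_form m n (word_product as) else 0)"
  unfolding F012_def multilinear_extension_right_empty[OF triangle_value_right_empty]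
    triangle_value_iff sum_simplex
  by (simp only: insert_iff empty_iff prod.inject simplex.distinct word_sum_False
      word_sum_block_word triangle_form_def bit_ring_simps)

section \<open>Evaluation of the operator on the triangle family\<close>

lemma D_op_triangle_family_right_empty:
  "D_op F012 as m [] n = F01 as m [] n + F02 as m [] n + F12 as m [] n"
proof (cases "as = []")
  case True
  have "D_op F012 [] m [] n =
      triangle_form (differential m) n 1 + triangle_form m (differential n) 1"
    by (simp only: D_op_def triangle_family list.size list.map prod_list.Nil lessThan_0 sum.empty
        simp_thms if_True add_0_left add_0_right)
  \<comment> \<open>For the empty word the matrix is 1, so the commutator and both remainders
    vanish.\<close>
  moreover have "triangle_form m n (jordan_block * 1 + 1 * jordan_block) = 0"
    by (simp only: triangle_form_def upper_ring_defs upper.sel jordan_block_def bit_ring_simps)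
  moreover have "e01 1 = 0" "e12 1 = 0"
    by (simp_all only: one_upper_def upper.sel)
  ultimately show ?thesis
    using triangle_form_differential[of m n 1]
    by (simp only: True edge_families list.map prod_list.Nil simp_thms if_True mult_zero_left add_0_right)
next
  case False
  let ?T = "word_product as"
  have hd: "word_matrix (hd as) * word_product (tl as) = ?T"
    using False by (cases as) simp_all
  have last: "word_product (butlast as) * word_matrix (last as) = ?T"
    using False by (cases as rule: rev_cases) simp_all
  have merge_right: "triangle_form m (n * hd as) (word_product (tl as)) =
      triangle_form m n (right_matrix (hd as) * word_product (tl as))
      + e01 ?T * (coeff m E0 * coeff n E0)"
    unfolding hd[symmetric] triangle_form_right_matrix[symmetric] by (simp only: bit_cancel)
  have merge_left: "triangle_form (last as * m) n (word_product (butlast as)) =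
      triangle_form m n (word_product (butlast as) * left_matrix (last as))
      + e12 ?T * (coeff m E2 * coeff n E2)"
    unfolding last[symmetric] triangle_form_left_matrix[symmetric] by (simp only: bit_cancel)
  have inner:
    "(\<Sum>i<length as. triangle_form m n (word_product (as[i := differential (as ! i)])))
      + (\<Sum>j<length as - 1. triangle_form m n (word_product (merge_at j as)))
    = triangle_form m n (right_matrix (hd as) * word_product (tl as))
      + triangle_form m n (word_product (butlast as) * left_matrix (last as))
      + triangle_form m n (jordan_block * ?T + ?T * jordan_block)"
    unfolding triangle_form_sum[symmetric] triangle_form_add[symmetric]
      prod_list_telescope[of word_matrix left_matrix right_matrix jordan_block,
        OF upper_char_two word_matrix_mult word_matrix_differential False] ..
  let ?s = "\<Sum>i<length as. triangle_form m n (word_product (as[i := differential (as ! i)]))"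
  let ?r = "\<Sum>j<length as - 1. triangle_form m n (word_product (merge_at j as))"
  have "D_op F012 as m [] n = (?s + ?r)
      + triangle_form (differential m) n ?T + triangle_form m (differential n) ?T
      + triangle_form m (n * hd as) (word_product (tl as))
      + triangle_form (last as * m) n (word_product (butlast as))"
    using False by (simp only: D_op_def triangle_family list.size lessThan_0 sum.empty
        if_True if_False simp_thms add_0_left add_0_right ac_simps)
  \<comment> \<open>The end terms from \<open>inner\<close> cancel those from
    \<open>merge_right\<close> and \<open>merge_left\<close>.\<close>
  also have "\<dots> = triangle_form (differential m) n ?T + triangle_form m (differential n) ?T
      + triangle_form m n (jordan_block * ?T + ?T * jordan_block)
      + e01 ?T * (coeff m E0 * coeff n E0) + e12 ?T * (coeff m E2 * coeff n E2)"
    unfolding inner merge_right merge_left by (simp only: ac_simps bit_cancel)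
  finally show ?thesis
    unfolding triangle_form_differential edge_families by (simp only: simp_thms if_True)
qed

text \<open>With two or more right inputs every term still has one and vanishes; with a single one,
  only the products with \<open>m\<close> and \<open>n\<close> remain, and they are equal.\<close>

lemma D_op_triangle_family_right_nonempty:
  assumes "bs \<noteq> []"
  shows "D_op F012 as m bs n = 0"
proof (cases "tl bs")
  case Nil
  then obtain b where "bs = [b]"
    using assms by (cases bs) auto
  then show ?thesis
    by (simp add: D_op_def triangle_family triangle_form_mult_middle)
next
  case (Cons c cs)
  then obtain b where "bs = b # c # cs"
    using assms by (cases bs) auto
  then show ?thesis
    by (simp add: D_op_def triangle_family merge_at_def)
qed

theorem mainTheorem3:
  shows "D_op F012 = F01 + F02 + F12"
proof (intro ext)
  fix as m bs n
  show "D_op F012 as m bs n = (F01 + F02 + F12) as m bs n"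
    by (cases "bs = []") (simp_all add: D_op_triangle_family_right_empty
        D_op_triangle_family_right_nonempty edge_families)
qed

end
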